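(* Let $\alpha(L),\alpha(H),\sigma(L),\sigma(H)$ be real numbers with $\alpha(H)>\alpha(L)>0$, $\sigma(L)>0$, $\sigma(H)>0$, let $IR(s)=\alpha(s)/\sigma(s)$ for $s\in\{L,H\}$, and suppose $IR(H)\neq IR(L)$. Let the regime be random, equal to $H$ with probability $p$ and to $L$ with probability $1-p$, where $0<p<1$, and let $E$ denote expectation over the regime. Consider two portfolios: (i) the dynamic portfolio, which in each regime $s$ uses the active weight $\theta^*(s)=\alpha(s)/\sigma(s)^2$ maximizing the expected compound active return $\theta\,\alpha(s)-\tfrac12\theta^2\sigma(s)^2$ over $\theta\in\mathbb{R}$, so that its tracking error in regime $s$ is $TE^*(s)=\theta^*(s)\sigma(s)$; (ii) the static portfolio, which holds tracking error constant across regimes at the same average level $\bar T=E[TE^*]=p\,TE^*(H)+(1-p)\,TE^*(L)$, i.e. uses the positive active weight $\bar T/\sigma(s)$ in regime $s$. Then the dynamic portfolio has expected compound active return $$E\left[\tfrac12 IR^2\right]=\tfrac12\left[p\,IR(H)^2+(1-p)\,IR(L)^2\right],$$ and its expected compound active return minus that of the static portfolio equals $$\Delta=\tfrac12\left\{E[IR^2]-(E[IR])^2\right\}>0,$$ where $E[IR]=p\,IR(H)+(1-p)\,IR(L)$ and $E[IR^2]=p\,IR(H)^2+(1-p)\,IR(L)^2$.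
   Context: A portfolio manager chooses an active weight $\theta\in\mathbb{R}$, the deviation of the portfolio from a benchmark. There are two regimes, a low-risk state $L$ and a high-risk state $H$. In regime $s$, $\alpha(s)$ is the expected active return per unit of active weight and $\sigma(s)$ is the volatility of the active return. The tracking error of active weight $\theta$ in regime $s$ is $|\theta|\,\sigma(s)$, and the expected compound active return of active weight $\theta$ in regime $s$ is $\theta\,\alpha(s)-\tfrac12\,\theta^2\sigma(s)^2$. No upper bound is imposed on tracking error. $IR(s)$ is called the information ratio in regime $s$. The expected compound active return of a portfolio is the expectation over the regime of its expected compound active return in each regime. *)

theory Defs
  imports "HOL-Probability.Probability"
begin

datatype regime = Low | High

text \<open>
  Throughout, \<open>\<alpha>\<close> is the expected active return per unit of active weight and \<open>\<sigma>\<close> the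
  volatility of the active return, both depending on the regime. A portfolio is a function
  \<open>w\<close> assigning a real active weight to each regime, and \<open>Q\<close> is the law of the regime.
\<close>

definition info_ratio :: "(regime \<Rightarrow> real) \<Rightarrow> (regime \<Rightarrow> real) \<Rightarrow> regime \<Rightarrow> real" where
  "info_ratio \<alpha> \<sigma> s = \<alpha> s / \<sigma> s"

definition tracking_error :: "(regime \<Rightarrow> real) \<Rightarrow> real \<Rightarrow> regime \<Rightarrow> real" where
  "tracking_error \<sigma> \<theta> s = \<bar>\<theta>\<bar> * \<sigma> s"

definition compound_return ::
  "(regime \<Rightarrow> real) \<Rightarrow> (regime \<Rightarrow> real) \<Rightarrow> real \<Rightarrow> regime \<Rightarrow> real" where
  "compound_return \<alpha> \<sigma> \<theta> s = \<theta> * \<alpha> s - 1 / 2 * \<theta>\<^sup>2 * (\<sigma> s)\<^sup>2"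

definition portfolio_return ::
  "regime pmf \<Rightarrow> (regime \<Rightarrow> real) \<Rightarrow> (regime \<Rightarrow> real) \<Rightarrow> (regime \<Rightarrow> real) \<Rightarrow> real" where
  "portfolio_return Q \<alpha> \<sigma> w = measure_pmf.expectation Q (\<lambda>s. compound_return \<alpha> \<sigma> (w s) s)"

definition dynamic_weight :: "(regime \<Rightarrow> real) \<Rightarrow> (regime \<Rightarrow> real) \<Rightarrow> regime \<Rightarrow> real" where
  "dynamic_weight \<alpha> \<sigma> s = \<alpha> s / (\<sigma> s)\<^sup>2"

definition mean_tracking_error ::
  "regime pmf \<Rightarrow> (regime \<Rightarrow> real) \<Rightarrow> (regime \<Rightarrow> real) \<Rightarrow> real" where
  "mean_tracking_error Q \<alpha> \<sigma> =
     measure_pmf.expectation Q (\<lambda>s. tracking_error \<sigma> (dynamic_weight \<alpha> \<sigma> s) s)"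

definition static_weight ::
  "regime pmf \<Rightarrow> (regime \<Rightarrow> real) \<Rightarrow> (regime \<Rightarrow> real) \<Rightarrow> regime \<Rightarrow> real" where
  "static_weight Q \<alpha> \<sigma> s = mean_tracking_error Q \<alpha> \<sigma> / \<sigma> s"

end

theory Submission
  imports Defs
begin

text \<open>
  Completing the square, a weight \<open>\<theta>\<close> in a regime with volatility \<open>\<sigma>\<close> and information ratio \<open>IR\<close>
  earns \<open>(IR\<^sup>2 - (\<theta> \<sigma> - IR)\<^sup>2) / 2\<close>. The dynamic weight makes the penalty vanish, while the static
  weight has \<open>\<theta> \<sigma> = E[IR]\<close> in every regime, so its expected penalty is half the variance of \<open>IR\<close>,
  which is \<open>p (1 - p) (IR(H) - IR(L))\<^sup>2 / 2\<close>.
\<close>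

text \<open>With only two regimes the integral is a finite sum. This turns every expectation below
  into a polynomial in \<open>p\<close> and the values at the two regimes, so no integrability
  argument is needed.\<close>

lemma expectation_regime:
  fixes f :: "regime \<Rightarrow> real"
  shows "measure_pmf.expectation Q f = pmf Q High * f High + pmf Q Low * f Low"
proof -
  have "measure_pmf.expectation Q f = (\<Sum>s\<in>{Low, High}. f s * pmf Q s)"
    by (rule integral_measure_pmf_real) (use regime.exhaust in auto)
  then show ?thesis
    by (simp add: mult.commute)
qed

text \<open>Separates what the regime offers from what the choice of weight loses. Optimality of the
  dynamic weight and its gain over the static one are both read off from the squared term.\<close>

lemma compound_return_complete_square:
  assumes "\<sigma> s \<noteq> 0"
  shows "compound_return \<alpha> \<sigma> \<theta> s =
    1 / 2 * (info_ratio \<alpha> \<sigma> s)\<^sup>2 - 1 / 2 * (\<theta> * \<sigma> s - info_ratio \<alpha> \<sigma> s)\<^sup>2"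
  using assms by (simp add: compound_return_def info_ratio_def power2_eq_square field_simps)

text \<open>One factor of the volatility cancels. At zero volatility both sides are 0, since
  division by zero gives 0, so the rule rewrites without a side condition.\<close>

lemma dynamic_weight_times_volatility: "dynamic_weight \<alpha> \<sigma> s * \<sigma> s = info_ratio \<alpha> \<sigma> s"
  by (simp add: dynamic_weight_def info_ratio_def power2_eq_square)

text \<open>The penalty is a square that vanishes at exactly one weight, so the maximizer exists and
  is unique.\<close>

lemma is_arg_max_compound_return_iff:
  assumes "\<sigma> s \<noteq> 0"
  shows "is_arg_max (\<lambda>x. compound_return \<alpha> \<sigma> x s) (\<lambda>x. True) \<theta> \<longleftrightarrow> \<theta> = dynamic_weight \<alpha> \<sigma> s"
proof -
  have opt: "compound_return \<alpha> \<sigma> (dynamic_weight \<alpha> \<sigma> s) s = 1 / 2 * (info_ratio \<alpha> \<sigma> s)\<^sup>2"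
    by (simp add: compound_return_complete_square assms dynamic_weight_times_volatility)
  have le: "compound_return \<alpha> \<sigma> x s \<le> 1 / 2 * (info_ratio \<alpha> \<sigma> s)\<^sup>2" for x
    by (simp add: compound_return_complete_square assms)
  have "compound_return \<alpha> \<sigma> \<theta> s = 1 / 2 * (info_ratio \<alpha> \<sigma> s)\<^sup>2 \<longleftrightarrow> \<theta> * \<sigma> s = info_ratio \<alpha> \<sigma> s"
    by (simp add: compound_return_complete_square assms)
  also have "\<dots> \<longleftrightarrow> \<theta> = dynamic_weight \<alpha> \<sigma> s"
    \<comment> \<open>Writing the information ratio as dynamic weight times volatility lets the
      nonzero volatility cancel on both sides.\<close>
    using assms by (simp flip: dynamic_weight_times_volatility)
  finally have eq: "compound_return \<alpha> \<sigma> \<theta> s = 1 / 2 * (info_ratio \<alpha> \<sigma> s)\<^sup>2 \<longleftrightarrow>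
    \<theta> = dynamic_weight \<alpha> \<sigma> s" .
  show ?thesis
  proof
    assume "is_arg_max (\<lambda>x. compound_return \<alpha> \<sigma> x s) (\<lambda>x. True) \<theta>"
    \<comment> \<open>A maximizer is not beaten by the dynamic weight, which attains the upper bound
      \<open>le\<close>; hence it attains that bound too.\<close>
    then have "\<not> compound_return \<alpha> \<sigma> \<theta> s < compound_return \<alpha> \<sigma> (dynamic_weight \<alpha> \<sigma> s) s"
      by (auto simp: is_arg_max_def)
    then show "\<theta> = dynamic_weight \<alpha> \<sigma> s"
      using le[of \<theta>] opt eq by linarith
  next
    assume "\<theta> = dynamic_weight \<alpha> \<sigma> s"
    then show "is_arg_max (\<lambda>x. compound_return \<alpha> \<sigma> x s) (\<lambda>x. True) \<theta>"
      unfolding is_arg_max_def using le opt by (metis not_less)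
  qed
qed

theorem proposition3:
  fixes \<alpha> \<sigma> :: "regime \<Rightarrow> real" and p :: real and Q :: "regime pmf"
  assumes "\<alpha> High > \<alpha> Low" and "\<alpha> Low > 0"
    and "\<sigma> Low > 0" and "\<sigma> High > 0"
    and "info_ratio \<alpha> \<sigma> High \<noteq> info_ratio \<alpha> \<sigma> Low"
    and "0 < p" and "p < 1"
    and "pmf Q High = p" and "pmf Q Low = 1 - p"
  shows
    "(\<forall>s \<theta>. is_arg_max (\<lambda>x. compound_return \<alpha> \<sigma> x s) (\<lambda>x. True) \<theta>
             \<longleftrightarrow> \<theta> = dynamic_weight \<alpha> \<sigma> s) \<and>
     (\<forall>s. tracking_error \<sigma> (dynamic_weight \<alpha> \<sigma> s) s = dynamic_weight \<alpha> \<sigma> s * \<sigma> s) \<and>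
     mean_tracking_error Q \<alpha> \<sigma> =
       p * tracking_error \<sigma> (dynamic_weight \<alpha> \<sigma> High) High
       + (1 - p) * tracking_error \<sigma> (dynamic_weight \<alpha> \<sigma> Low) Low \<and>
     (\<forall>s. static_weight Q \<alpha> \<sigma> s > 0 \<and>
          tracking_error \<sigma> (static_weight Q \<alpha> \<sigma> s) s = mean_tracking_error Q \<alpha> \<sigma>) \<and>
     measure_pmf.expectation Q (info_ratio \<alpha> \<sigma>) =
       p * info_ratio \<alpha> \<sigma> High + (1 - p) * info_ratio \<alpha> \<sigma> Low \<and>
     measure_pmf.expectation Q (\<lambda>s. (info_ratio \<alpha> \<sigma> s)\<^sup>2) =
       p * (info_ratio \<alpha> \<sigma> High)\<^sup>2 + (1 - p) * (info_ratio \<alpha> \<sigma> Low)\<^sup>2 \<and>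
     portfolio_return Q \<alpha> \<sigma> (dynamic_weight \<alpha> \<sigma>) =
       measure_pmf.expectation Q (\<lambda>s. 1 / 2 * (info_ratio \<alpha> \<sigma> s)\<^sup>2) \<and>
     measure_pmf.expectation Q (\<lambda>s. 1 / 2 * (info_ratio \<alpha> \<sigma> s)\<^sup>2) =
       1 / 2 * (p * (info_ratio \<alpha> \<sigma> High)\<^sup>2 + (1 - p) * (info_ratio \<alpha> \<sigma> Low)\<^sup>2) \<and>
     portfolio_return Q \<alpha> \<sigma> (dynamic_weight \<alpha> \<sigma>) -
       portfolio_return Q \<alpha> \<sigma> (static_weight Q \<alpha> \<sigma>) =
       1 / 2 * (measure_pmf.expectation Q (\<lambda>s. (info_ratio \<alpha> \<sigma> s)\<^sup>2)
                - (measure_pmf.expectation Q (info_ratio \<alpha> \<sigma>))\<^sup>2) \<and>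
     1 / 2 * (measure_pmf.expectation Q (\<lambda>s. (info_ratio \<alpha> \<sigma> s)\<^sup>2)
              - (measure_pmf.expectation Q (info_ratio \<alpha> \<sigma>))\<^sup>2) > 0"
proof -
  define a b where "a = info_ratio \<alpha> \<sigma> High" and "b = info_ratio \<alpha> \<sigma> Low"
  define T where "T = p * a + (1 - p) * b"
  note expectation = expectation_regime[of Q, unfolded assms(8,9)]
  have \<sigma>: "\<sigma> s > 0" for s
    using assms(3,4) by (cases s) auto
  have \<alpha>: "\<alpha> s > 0" for s
    using assms(1,2) by (cases s) auto
  have IR: "info_ratio \<alpha> \<sigma> s > 0" for s
    using \<alpha> \<sigma> by (simp add: info_ratio_def)
  have "dynamic_weight \<alpha> \<sigma> s > 0" for s
    using \<alpha>[of s] \<sigma>[of s] by (simp add: dynamic_weight_def)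
  \<comment> \<open>Positivity of \<alpha> enters here: the absolute value drops, so the dynamic
    tracking error is the information ratio itself, and its mean is E[IR] rather than E|IR|.\<close>
  then have TE: "tracking_error \<sigma> (dynamic_weight \<alpha> \<sigma> s) s = dynamic_weight \<alpha> \<sigma> s * \<sigma> s" for s
    by (simp add: tracking_error_def abs_of_pos)
  have mean: "mean_tracking_error Q \<alpha> \<sigma> = T"
    by (simp add: mean_tracking_error_def expectation TE dynamic_weight_times_volatility
        T_def a_def b_def)
  have "T > 0"
    using IR assms(6,7) by (simp add: T_def a_def b_def add_pos_pos)
  then have static_pos: "static_weight Q \<alpha> \<sigma> s > 0" for s
    using \<sigma>[of s] by (simp add: static_weight_def mean)
  have static_TE: "static_weight Q \<alpha> \<sigma> s * \<sigma> s = T" for s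
    using \<sigma>[of s] by (simp add: static_weight_def mean)
  have return: "compound_return \<alpha> \<sigma> \<theta> s =
      1 / 2 * (info_ratio \<alpha> \<sigma> s)\<^sup>2 - 1 / 2 * (\<theta> * \<sigma> s - info_ratio \<alpha> \<sigma> s)\<^sup>2" for \<theta> s
    using \<sigma>[of s] by (simp add: compound_return_complete_square)
  have dynamic: "portfolio_return Q \<alpha> \<sigma> (dynamic_weight \<alpha> \<sigma>) =
      measure_pmf.expectation Q (\<lambda>s. 1 / 2 * (info_ratio \<alpha> \<sigma> s)\<^sup>2)"
    by (simp add: portfolio_return_def return dynamic_weight_times_volatility)
  have static: "portfolio_return Q \<alpha> \<sigma> (static_weight Q \<alpha> \<sigma>) =
      p * (1 / 2 * a\<^sup>2 - 1 / 2 * (T - a)\<^sup>2) + (1 - p) * (1 / 2 * b\<^sup>2 - 1 / 2 * (T - b)\<^sup>2)"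
    by (simp add: portfolio_return_def expectation return static_TE a_def b_def)
  \<comment> \<open>The expected penalty is half the mean squared deviation of the ratios from
    \<open>T\<close>. As \<open>T\<close> is their mean, the cross term contributes -2
    \<open>T\<close> squared, leaving second moment minus squared mean.\<close>
  have gain: "1 / 2 * (p * a\<^sup>2 + (1 - p) * b\<^sup>2) -
      (p * (1 / 2 * a\<^sup>2 - 1 / 2 * (T - a)\<^sup>2) + (1 - p) * (1 / 2 * b\<^sup>2 - 1 / 2 * (T - b)\<^sup>2)) =
      1 / 2 * ((p * a\<^sup>2 + (1 - p) * b\<^sup>2) - T\<^sup>2)"
    by (simp add: T_def power2_eq_square field_simps)
  \<comment> \<open>Variance of a two-point distribution: strictly positive because both regimes
    have positive probability and the two ratios differ.\<close>
  have "(p * a\<^sup>2 + (1 - p) * b\<^sup>2) - T\<^sup>2 = p * (1 - p) * (a - b)\<^sup>2"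
    by (simp add: T_def power2_eq_square algebra_simps)
  also have "\<dots> > 0"
    using assms(5-7) by (simp add: a_def b_def)
  finally have pos: "(p * a\<^sup>2 + (1 - p) * b\<^sup>2) - T\<^sup>2 > 0" .
  have E1: "measure_pmf.expectation Q (info_ratio \<alpha> \<sigma>) = T"
    by (simp add: expectation T_def a_def b_def)
  have E2: "measure_pmf.expectation Q (\<lambda>s. (info_ratio \<alpha> \<sigma> s)\<^sup>2) = p * a\<^sup>2 + (1 - p) * b\<^sup>2"
    by (simp add: expectation a_def b_def)
  have E2_half: "measure_pmf.expectation Q (\<lambda>s. 1 / 2 * (info_ratio \<alpha> \<sigma> s)\<^sup>2) =
      1 / 2 * (p * a\<^sup>2 + (1 - p) * b\<^sup>2)"
    by (simp only: integral_mult_right_zero E2)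
  show ?thesis
  proof (intro conjI allI)
    show "is_arg_max (\<lambda>x. compound_return \<alpha> \<sigma> x s) (\<lambda>x. True) \<theta> \<longleftrightarrow>
        \<theta> = dynamic_weight \<alpha> \<sigma> s" for s \<theta>
      using \<sigma>[of s] by (simp add: is_arg_max_compound_return_iff)
    show "tracking_error \<sigma> (static_weight Q \<alpha> \<sigma> s) s = mean_tracking_error Q \<alpha> \<sigma>" for s
      using static_pos[of s] by (simp add: tracking_error_def static_TE mean)
    show "portfolio_return Q \<alpha> \<sigma> (dynamic_weight \<alpha> \<sigma>) -
        portfolio_return Q \<alpha> \<sigma> (static_weight Q \<alpha> \<sigma>) =
        1 / 2 * (measure_pmf.expectation Q (\<lambda>s. (info_ratio \<alpha> \<sigma> s)\<^sup>2)
                - (measure_pmf.expectation Q (info_ratio \<alpha> \<sigma>))\<^sup>2)"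
      unfolding dynamic static E1 E2 E2_half by (rule gain)
    show "0 < 1 / 2 * (measure_pmf.expectation Q (\<lambda>s. (info_ratio \<alpha> \<sigma> s)\<^sup>2)
                - (measure_pmf.expectation Q (info_ratio \<alpha> \<sigma>))\<^sup>2)"
      unfolding E1 E2 using pos by simp
  qed (use TE static_pos dynamic E1 E2 E2_half in
      \<open>simp_all add: mean_tracking_error_def expectation T_def a_def b_def\<close>)
qed

end
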